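(* For every separable state $\varrho_{sep}$ of a finite-dimensional bipartite system, $$\mathcal{M}(\varrho_{sep})\leq 0.$$
   Context: Let $\mathcal{H}=\mathcal{H}_A\otimes\mathcal{H}_B$ be a finite-dimensional bipartite Hilbert space; a state is a density matrix on $\mathcal{H}$. $\mathcal{PS}$ denotes the set of product states $\varrho_A\otimes\varrho_B$; a separable state is a convex combination of product states. A von Neumann measurement $\mathcal{P}=\{P_i\}$ is a complete family of mutually orthogonal rank-one projectors on $\mathcal{H}$ (not necessarily of product form) summing to the identity. The Klein entropy is $H(\varrho,\mathcal{P})=-\sum_i p_i\log_2 p_i$ with $p_i=\mathrm{Tr}(\varrho P_i)$ and $0\log_2 0=0$. The entropic entanglement parameter is $$\mathcal{M}(\varrho)=\sup_{\mathcal{P}}\Big(\inf_{\delta\in\mathcal{PS}}H(\delta,\mathcal{P})-H(\varrho,\mathcal{P})\Big),$$ the supremum being over all von Neumann measurements. *)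

theory Defs
  imports "HOL-Analysis.Analysis"
begin

text \<open>
  The Hilbert space is \<open>complex ^ 'n\<close>; the tensor product of \<open>complex ^ 'a\<close> and \<open>complex ^ 'b\<close>
  is \<open>complex ^ ('a \<times> 'b)\<close>. Operators are matrices with respect to the standard bases, and
  \<open>$\<close> selects the row first, then the column.
\<close>

definition conj_transpose :: "complex ^ 'n ^ 'm \<Rightarrow> complex ^ 'm ^ 'n" where
  "conj_transpose A = (\<chi> i j. cnj (A $ j $ i))"

definition hermitian :: "complex ^ 'n ^ 'n \<Rightarrow> bool" where
  "hermitian A \<longleftrightarrow> conj_transpose A = A"

text \<open>
  The quadratic form of a Hermitian matrix is real-valued, so taking the real part loses nothing.
\<close>
definition pos_semidef :: "complex ^ 'n ^ 'n \<Rightarrow> bool" where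
  "pos_semidef A \<longleftrightarrow>
     hermitian A \<and> (\<forall>v. 0 \<le> Re (\<Sum>i\<in>UNIV. cnj (v $ i) * (A *v v) $ i))"

definition density_matrix :: "complex ^ 'n ^ 'n \<Rightarrow> bool" where
  "density_matrix \<rho> \<longleftrightarrow> pos_semidef \<rho> \<and> trace \<rho> = 1"

definition kron ::
    "complex ^ 'a ^ 'a \<Rightarrow> complex ^ 'b ^ 'b \<Rightarrow> complex ^ ('a::finite \<times> 'b::finite) ^ ('a \<times> 'b)" where
  "kron A B = (\<chi> i j. A $ fst i $ fst j * B $ snd i $ snd j)"

definition product_states :: "(complex ^ ('a::finite \<times> 'b::finite) ^ ('a \<times> 'b)) set" where
  "product_states = {kron \<rho>A \<rho>B |\<rho>A \<rho>B. density_matrix \<rho>A \<and> density_matrix \<rho>B}"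

definition separable_states :: "(complex ^ ('a::finite \<times> 'b::finite) ^ ('a \<times> 'b)) set" where
  "separable_states = convex hull product_states"

definition rank_one_projector :: "complex ^ 'n ^ 'n \<Rightarrow> bool" where
  "rank_one_projector P \<longleftrightarrow> hermitian P \<and> P ** P = P \<and> rank P = 1"

text \<open>
  A measurement is the set of its projectors: mutually orthogonal rank-one projectors are
  distinct, so no indexing is needed.
\<close>
definition von_neumann_measurement :: "(complex ^ 'n ^ 'n) set \<Rightarrow> bool" where
  "von_neumann_measurement \<P> \<longleftrightarrow>
     finite \<P> \<and> (\<forall>P\<in>\<P>. rank_one_projector P) \<and>
     (\<forall>P\<in>\<P>. \<forall>Q\<in>\<P>. P \<noteq> Q \<longrightarrow> P ** Q = 0) \<and>
     (\<Sum>P\<in>\<P>. P) = mat 1"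

text \<open>
  The trace is real when \<open>\<rho>\<close> and \<open>P\<close> are Hermitian. The convention \<open>0 * log 2 0 = 0\<close> holds
  automatically.
\<close>
definition outcome_prob :: "complex ^ 'n ^ 'n \<Rightarrow> complex ^ 'n ^ 'n \<Rightarrow> real" where
  "outcome_prob \<rho> P = Re (trace (\<rho> ** P))"

definition klein_entropy :: "complex ^ 'n ^ 'n \<Rightarrow> (complex ^ 'n ^ 'n) set \<Rightarrow> real" where
  "klein_entropy \<rho> \<P> = - (\<Sum>P\<in>\<P>. outcome_prob \<rho> P * log 2 (outcome_prob \<rho> P))"

text \<open>
  For a state and a measurement, the Klein entropy lies between 0 and the binary logarithm of the
  dimension. Hence the infimum and, when \<open>\<rho>\<close> is a state, the supremum below are over nonempty
  bounded sets of reals, and the conditionally complete operations give the usual values.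
\<close>
definition entanglement_parameter ::
    "complex ^ ('a::finite \<times> 'b::finite) ^ ('a \<times> 'b) \<Rightarrow> real" where
  "entanglement_parameter \<rho> =
     (SUP \<P> \<in> {\<P>. von_neumann_measurement \<P>}.
        (INF \<delta> \<in> product_states. klein_entropy \<delta> \<P>) - klein_entropy \<rho> \<P>)"

end

(*
  For a fixed measurement the outcome probabilities are linear in the state and - x log x is
  concave, so the set of operators with nonnegative outcome probabilities whose Klein entropy is at
  least the infimum over product states is convex; it contains the product states and hence their
  convex hull. The infimum is over a set bounded below because a Kronecker product of states is a
  state, which reduces to the case where one factor has rank one by Cholesky elimination.
*)
theory Submission
  imports Defs
begin

section \<open>Sesquilinear forms of Hermitian and positive semidefinite matrices\<close>

definition quad_form :: "complex ^ 'n ^ 'n \<Rightarrow> complex ^ 'n \<Rightarrow> complex ^ 'n \<Rightarrow> complex" where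
  "quad_form A v w = (\<Sum>i\<in>UNIV. \<Sum>j\<in>UNIV. cnj (v $ i) * A $ i $ j * w $ j)"

definition outer :: "complex ^ 'n \<Rightarrow> complex ^ 'n ^ 'n" where
  "outer a = (\<chi> i j. a $ i * cnj (a $ j))"

lemma cmod_sq: "(cmod z)\<^sup>2 = Re z * Re z + Im z * Im z"
  by (simp add: cmod_power2 flip: power2_eq_square)

lemma hermitian_iff: "hermitian A \<longleftrightarrow> (\<forall>i j. cnj (A $ j $ i) = A $ i $ j)"
  by (simp add: hermitian_def conj_transpose_def vec_eq_iff)

lemma pos_semidef_iff:
  "pos_semidef A \<longleftrightarrow> hermitian A \<and> (\<forall>v. 0 \<le> Re (quad_form A v v))"
  by (simp add: pos_semidef_def quad_form_def matrix_vector_mult_def sum_distrib_left mult.assoc)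

lemma pos_semidef_add:
  assumes "pos_semidef A" "pos_semidef B"
  shows "pos_semidef (A + B)"
proof -
  have "quad_form (A + B) v v = quad_form A v v + quad_form B v v" for v
    by (simp add: quad_form_def algebra_simps sum.distrib)
  then show ?thesis
    using assms by (auto simp: pos_semidef_iff hermitian_iff)
qed

lemma quad_form_add_right: "quad_form A v (w + x) = quad_form A v w + quad_form A v x"
  by (simp add: quad_form_def algebra_simps sum.distrib)

lemma quad_form_add_left: "quad_form A (v + w) x = quad_form A v x + quad_form A w x"
  by (simp add: quad_form_def algebra_simps sum.distrib)

lemma quad_form_smult_right: "quad_form A v (c *s w) = c * quad_form A v w"
  by (simp add: quad_form_def algebra_simps sum_distrib_left)

lemma quad_form_smult_left: "quad_form A (c *s v) w = cnj c * quad_form A v w"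
  by (simp add: quad_form_def algebra_simps sum_distrib_left)

lemma quad_form_hermitian:
  assumes "hermitian A"
  shows "quad_form A w v = cnj (quad_form A v w)"
proof -
  have "cnj (quad_form A v w) = (\<Sum>i\<in>UNIV. \<Sum>j\<in>UNIV. v $ i * A $ j $ i * cnj (w $ j))"
    using assms by (simp add: quad_form_def hermitian_iff)
  also have "\<dots> = (\<Sum>j\<in>UNIV. \<Sum>i\<in>UNIV. v $ i * A $ j $ i * cnj (w $ j))"
    by (rule sum.swap)
  also have "\<dots> = quad_form A w v"
    by (simp add: quad_form_def mult_ac)
  finally show ?thesis ..
qed

lemma quad_form_axis_left: "quad_form A (axis i 1) v = (\<Sum>j\<in>UNIV. A $ i $ j * v $ j)"
proof -
  have "quad_form A (axis i 1) v
      = (\<Sum>k\<in>UNIV. if k = i then \<Sum>j\<in>UNIV. A $ k $ j * v $ j else 0)"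
    unfolding quad_form_def by (intro sum.cong) (auto simp: axis_def)
  then show ?thesis by simp
qed

lemma quad_form_axis_axis: "quad_form A (axis i 1) (axis j 1) = A $ i $ j"
proof -
  have "(\<Sum>k\<in>UNIV. A $ i $ k * axis j 1 $ k) = (\<Sum>k\<in>UNIV. if k = j then A $ i $ k else 0)"
    by (intro sum.cong) (auto simp: axis_def)
  then show ?thesis by (simp add: quad_form_axis_left)
qed

lemma hermitian_diag_real: "hermitian A \<Longrightarrow> A $ i $ i = complex_of_real (Re (A $ i $ i))"
  by (metis hermitian_iff complex_cnj_cancel_iff complex_eq_iff cnj.sel of_real_Re Reals_cnj_iff)

lemma pos_semidef_diag_nonneg: "pos_semidef A \<Longrightarrow> 0 \<le> Re (A $ i $ i)"
  by (metis pos_semidef_iff quad_form_axis_axis)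

text \<open>Hermitian symmetry makes the two cross terms complex conjugates, so their real parts
  coincide. Restricted to a line, positivity thus becomes a statement about a real quadratic in
  \<open>c\<close>, to be exploited by a good choice of \<open>c\<close>.\<close>

lemma quad_form_expand:
  assumes "hermitian A"
  shows "Re (quad_form A (v + c *s w) (v + c *s w))
       = Re (quad_form A v v) + 2 * Re (cnj c * quad_form A w v) + (cmod c)\<^sup>2 * Re (quad_form A w w)"
proof -
  have "Re (c * (cnj c * z)) = (cmod c)\<^sup>2 * Re z" for z
    by (simp add: cmod_sq algebra_simps)
  moreover have "Re (c * quad_form A v w) = Re (cnj c * quad_form A w v)"
    by (subst quad_form_hermitian[OF assms, of w]) simp
  moreover have "quad_form A (v + c *s w) (v + c *s w)
      = quad_form A v v + c * quad_form A v w + cnj c * quad_form A w v + c * (cnj c * quad_form A w w)"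
    by (simp add: quad_form_add_left quad_form_add_right quad_form_smult_left
        quad_form_smult_right distrib_left)
  ultimately show ?thesis
    by (simp only: plus_complex.sel)
qed

text \<open>With a zero diagonal entry the quadratic term vanishes along the direction
  \<open>axis i 1\<close>, and a nonzero linear term would drive the form below zero.\<close>

lemma pos_semidef_row_zero:
  assumes "pos_semidef A" "A $ i $ i = 0"
  shows "A $ i $ j = 0"
proof (rule ccontr)
  assume nz: "A $ i $ j \<noteq> 0"
  define z where "z = A $ i $ j"
  \<comment> \<open>Chosen so that the linear term \<open>2 * t * (cmod z)\<^sup>2\<close> exceeds
    the constant term \<open>Re (A $ j $ j)\<close> for certain.\<close>
  define t where "t = (Re (A $ j $ j) + 1) / (cmod z)\<^sup>2"
  have h: "hermitian A" using assms by (simp add: pos_semidef_iff)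
  have "0 \<le> Re (quad_form A (axis j 1 + (- of_real t * z) *s axis i 1)
               (axis j 1 + (- of_real t * z) *s axis i 1))"
    using assms by (simp add: pos_semidef_iff)
  also have "\<dots> = Re (A $ j $ j) - 2 * t * (cmod z)\<^sup>2"
    unfolding quad_form_expand[OF h] quad_form_axis_axis z_def[symmetric] assms(2)
    by (simp add: cmod_sq algebra_simps)
  also have "\<dots> = - Re (A $ j $ j) - 2"
    using nz by (simp add: t_def z_def)
  finally show False
    using pos_semidef_diag_nonneg[OF assms(1), of j] by simp
qed

section \<open>Kronecker products of positive semidefinite matrices\<close>

lemma sum_UNIV_prod:
  "(\<Sum>p\<in>UNIV. f p) = (\<Sum>i\<in>UNIV. \<Sum>j\<in>UNIV. f (i, j))"
  for f :: "'a::finite \<times> 'b::finite \<Rightarrow> 'c::comm_monoid_add"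
  by (simp add: sum.cartesian_product flip: UNIV_Times_UNIV)

text \<open>Writing V for the tensor product of the column \<open>a\<close> with the identity,
  \<open>kron (outer a) B\<close> is V B V*. The vector on the right is V* v, the contraction of
  \<open>v\<close> with \<open>a\<close> in the first factor.\<close>

lemma quad_form_kron_outer:
  "quad_form (kron (outer a) B) v v
     = quad_form B (\<chi> j. \<Sum>i\<in>UNIV. cnj (a $ i) * v $ (i, j)) (\<chi> j. \<Sum>i\<in>UNIV. cnj (a $ i) * v $ (i, j))"
proof -
  have "quad_form (kron (outer a) B) v v
      = (\<Sum>i\<in>UNIV. \<Sum>j\<in>UNIV. \<Sum>k\<in>UNIV. \<Sum>l\<in>UNIV.
           a $ i * cnj (v $ (i, j)) * B $ j $ l * (cnj (a $ k) * v $ (k, l)))"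
    by (simp add: quad_form_def kron_def outer_def sum_UNIV_prod mult_ac)
  also have "\<dots> = (\<Sum>j\<in>UNIV. \<Sum>i\<in>UNIV. \<Sum>l\<in>UNIV. \<Sum>k\<in>UNIV.
           a $ i * cnj (v $ (i, j)) * B $ j $ l * (cnj (a $ k) * v $ (k, l)))"
    by (subst sum.swap) (intro sum.cong refl sum.swap)
  also have "\<dots> = (\<Sum>j\<in>UNIV. \<Sum>l\<in>UNIV. \<Sum>i\<in>UNIV. \<Sum>k\<in>UNIV.
           a $ i * cnj (v $ (i, j)) * B $ j $ l * (cnj (a $ k) * v $ (k, l)))"
    by (intro sum.cong refl sum.swap)
  also have "\<dots> = quad_form B (\<chi> j. \<Sum>i\<in>UNIV. cnj (a $ i) * v $ (i, j))
      (\<chi> j. \<Sum>i\<in>UNIV. cnj (a $ i) * v $ (i, j))"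
    unfolding quad_form_def
    by (simp add: sum_distrib_left sum_distrib_right)
      (rule sum.cong[OF refl], rule sum.cong[OF refl], rule sum.swap)
  finally show ?thesis .
qed

lemma pos_semidef_kron_outer:
  assumes "pos_semidef B"
  shows "pos_semidef (kron (outer a) B)"
proof -
  have "cnj (B $ j $ i) = B $ i $ j" for i j
    using assms by (simp add: pos_semidef_iff hermitian_iff)
  then have "hermitian (kron (outer a) B)"
    by (simp add: hermitian_iff kron_def outer_def mult_ac)
  then show ?thesis
    using assms by (simp add: pos_semidef_iff quad_form_kron_outer)
qed

text \<open>The form of the Schur complement at \<open>v\<close> is the minimum of the form of \<open>A\<close> over the line
  through \<open>v\<close> in direction \<open>axis i 1\<close>, hence nonnegative.\<close>
lemma pos_semidef_schur_complement:
  assumes "pos_semidef A" "A $ i $ i \<noteq> 0"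
  obtains a where "pos_semidef (A - outer a)" "outer a $ i $ i = A $ i $ i"
proof
  define d where "d = Re (A $ i $ i)"
  \<comment> \<open>The Cholesky column for pivot \<open>i\<close>: with this scaling
    \<open>outer a\<close> agrees with \<open>A\<close> on row and column \<open>i\<close>.\<close>
  define a where "a = (\<chi> k. A $ k $ i / of_real (sqrt d))"
  have h: "hermitian A" and hc: "\<And>k l. cnj (A $ k $ l) = A $ l $ k"
    using assms by (simp_all add: pos_semidef_iff hermitian_iff)
  have Aii: "A $ i $ i = of_real d"
    unfolding d_def by (rule hermitian_diag_real[OF h])
  have "d \<noteq> 0"
    using assms(2) Aii by auto
  moreover have "d \<ge> 0"
    unfolding d_def by (rule pos_semidef_diag_nonneg[OF assms(1)])
  ultimately have d: "d > 0"
    by simp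
  have dd: "complex_of_real (sqrt d) * complex_of_real (sqrt d) = of_real d"
    using d by (simp flip: of_real_mult)
  have outer: "outer a $ k $ l = A $ k $ i * A $ i $ l / of_real d" for k l
    by (simp add: outer_def a_def hc dd)
  show "outer a $ i $ i = A $ i $ i"
    using d by (simp add: outer Aii)
  have "0 \<le> Re (quad_form (A - outer a) v v)" for v
  proof -
    define z where "z = quad_form A (axis i 1) v"
    have "quad_form (outer a) v v
        = (\<Sum>k\<in>UNIV. \<Sum>l\<in>UNIV. cnj (A $ i $ k * v $ k) * (A $ i $ l * v $ l) / of_real d)"
      by (simp add: quad_form_def outer hc mult_ac)
    also have "\<dots> = cnj z * z / of_real d"
      by (simp add: z_def quad_form_axis_left sum_product sum_divide_distrib)
    finally have "Re (quad_form (outer a) v v) = (cmod z)\<^sup>2 / d"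
      by (simp add: cmod_sq mult.commute)
    moreover have "quad_form (A - outer a) v v = quad_form A v v - quad_form (outer a) v v"
      by (simp add: quad_form_def algebra_simps sum_subtractf)
    ultimately have schur: "Re (quad_form (A - outer a) v v) = Re (quad_form A v v) - (cmod z)\<^sup>2 / d"
      by simp
    \<comment> \<open>The minimiser of the real quadratic in \<open>c\<close> along
      \<open>axis i 1\<close>; the linear and quadratic terms then add up to
      \<open>- (cmod z)\<^sup>2 / d\<close>.\<close>
    define c where "c = - z / of_real d"
    have c: "Re (cnj c * z) = - (cmod z)\<^sup>2 / d"
      by (simp add: c_def cmod_sq algebra_simps diff_divide_distrib add_divide_distrib)
    have cc: "(cmod c)\<^sup>2 * d = (cmod z)\<^sup>2 / d"
      using d by (simp add: c_def norm_divide power_divide power2_eq_square)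
    have "0 \<le> Re (quad_form A (v + c *s axis i 1) (v + c *s axis i 1))"
      using assms by (simp add: pos_semidef_iff)
    then show ?thesis
      unfolding quad_form_expand[OF h] quad_form_axis_axis z_def[symmetric] Aii schur c Re_complex_of_real cc
      by simp
  qed
  moreover have "hermitian (A - outer a)"
    by (simp add: hermitian_iff outer hc mult.commute)
  ultimately show "pos_semidef (A - outer a)"
    by (simp add: pos_semidef_iff)
qed

text \<open>Induction on the number of nonzero diagonal entries of \<open>A\<close>: splitting off
  \<open>outer a\<close> clears one of them, and \<open>kron\<close> is additive in its first
  argument. Once the diagonal is zero, so is \<open>A\<close>.\<close>

lemma pos_semidef_kron:
  assumes "pos_semidef A" "pos_semidef B"
  shows "pos_semidef (kron A B)"
  using assms(1)
proof (induction "card {i. A $ i $ i \<noteq> 0}" arbitrary: A rule: less_induct)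
  case less
  show ?case
  proof (cases "\<exists>i. A $ i $ i \<noteq> 0")
    case True
    then obtain i where i: "A $ i $ i \<noteq> 0" by blast
    obtain a where a: "pos_semidef (A - outer a)" "outer a $ i $ i = A $ i $ i"
      using pos_semidef_schur_complement[OF less.prems i] .
    \<comment> \<open>No cleared entry reappears: the new diagonal entry is minus a square, yet
      nonnegative by positivity of the remainder.\<close>
    have zero: "(A - outer a) $ j $ j = 0" if "A $ j $ j = 0" for j
    proof -
      have "Re ((A - outer a) $ j $ j) = - (cmod (a $ j))\<^sup>2"
        using that by (simp add: outer_def cmod_sq)
      then have "a $ j = 0"
        using pos_semidef_diag_nonneg[OF a(1), of j] by simp
      then show ?thesis
        using that by (simp add: outer_def)
    qed
    have "{j. (A - outer a) $ j $ j \<noteq> 0} \<subset> {j. A $ j $ j \<noteq> 0}"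
    proof
      show "{j. (A - outer a) $ j $ j \<noteq> 0} \<subseteq> {j. A $ j $ j \<noteq> 0}"
        by (rule Collect_mono) (metis zero)
      have "i \<notin> {j. (A - outer a) $ j $ j \<noteq> 0}" "i \<in> {j. A $ j $ j \<noteq> 0}"
        using a(2) i by simp_all
      then show "{j. (A - outer a) $ j $ j \<noteq> 0} \<noteq> {j. A $ j $ j \<noteq> 0}"
        by metis
    qed
    then have "pos_semidef (kron (A - outer a) B)"
      by (intro less.hyps psubset_card_mono a(1)) simp_all
    moreover have "kron A B = kron (A - outer a) B + kron (outer a) B"
      by (simp add: kron_def vec_eq_iff algebra_simps)
    ultimately show ?thesis
      by (simp add: pos_semidef_add pos_semidef_kron_outer assms(2))
  next
    case False
    then have "kron A B = 0"
      using pos_semidef_row_zero[OF less.prems] by (simp add: kron_def vec_eq_iff)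
    then show ?thesis
      by (simp add: pos_semidef_iff hermitian_iff quad_form_def)
  qed
qed

lemma trace_kron: "trace (kron A B) = trace A * trace B"
  by (simp add: trace_def kron_def sum_UNIV_prod sum_product)

lemma density_matrix_kron:
  "density_matrix A \<Longrightarrow> density_matrix B \<Longrightarrow> density_matrix (kron A B)"
  by (simp add: density_matrix_def pos_semidef_kron trace_kron)

section \<open>Outcome probabilities and the lower bound on the Klein entropy\<close>

lemma outcome_prob_add: "outcome_prob (\<rho> + \<sigma>) P = outcome_prob \<rho> P + outcome_prob \<sigma> P"
  by (simp add: outcome_prob_def trace_def matrix_matrix_mult_def algebra_simps sum.distrib)

lemma outcome_prob_scaleR: "outcome_prob (c *\<^sub>R \<rho>) P = c * outcome_prob \<rho> P"
proof -
  have "trace ((c *\<^sub>R \<rho>) ** P) = c *\<^sub>R trace (\<rho> ** P)"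
    by (simp add: trace_def matrix_matrix_mult_def scaleR_sum_right)
  then show ?thesis
    by (simp add: outcome_prob_def)
qed

text \<open>Idempotence and cyclicity turn the trace into that of \<open>P ** (\<rho> ** P)\<close>,
  a sum of values of the form of \<open>\<rho>\<close> at the columns of \<open>P\<close>.\<close>

lemma outcome_prob_nonneg:
  assumes "pos_semidef \<rho>" "rank_one_projector P"
  shows "0 \<le> outcome_prob \<rho> P"
proof -
  have P: "hermitian P" "P ** P = P"
    using assms(2) by (simp_all add: rank_one_projector_def)
  have "trace (\<rho> ** P) = trace ((\<rho> ** P) ** P)"
    by (simp add: P(2) flip: matrix_mul_assoc)
  also have "\<dots> = trace (P ** (\<rho> ** P))"
    by (rule trace_mul_sym)
  also have "\<dots> = (\<Sum>k\<in>UNIV. quad_form \<rho> (column k P) (column k P))"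
    using P(1) by (simp add: trace_def matrix_matrix_mult_def quad_form_def column_def
        hermitian_iff sum_distrib_left mult.assoc)
  finally show ?thesis
    using assms(1) by (simp add: outcome_prob_def pos_semidef_iff sum_nonneg)
qed

lemma sum_outcome_prob:
  assumes "density_matrix \<rho>" "von_neumann_measurement \<P>"
  shows "(\<Sum>P\<in>\<P>. outcome_prob \<rho> P) = 1"
proof -
  have "finite \<P>"
    using assms(2) by (simp add: von_neumann_measurement_def)
  then have "trace (\<rho> ** (\<Sum>P\<in>\<P>. P)) = (\<Sum>P\<in>\<P>. trace (\<rho> ** P))"
    by induction (simp_all add: matrix_add_ldistrib trace_def sum.distrib)
  then have "(\<Sum>P\<in>\<P>. outcome_prob \<rho> P) = Re (trace (\<rho> ** (\<Sum>P\<in>\<P>. P)))"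
    by (simp only: outcome_prob_def Re_sum)
  then show ?thesis
    using assms by (simp add: von_neumann_measurement_def density_matrix_def)
qed

text \<open>Probabilities lie between 0 and 1, where the logarithm is nonpositive. This bounds the
  set of entropies below, so that its infimum is a genuine lower bound.\<close>

lemma klein_entropy_nonneg:
  assumes "density_matrix \<rho>" "von_neumann_measurement \<P>"
  shows "0 \<le> klein_entropy \<rho> \<P>"
proof -
  have nonneg: "0 \<le> outcome_prob \<rho> P" if "P \<in> \<P>" for P
    using assms that
    by (simp add: outcome_prob_nonneg density_matrix_def von_neumann_measurement_def)
  have "outcome_prob \<rho> P * log 2 (outcome_prob \<rho> P) \<le> 0" if "P \<in> \<P>" for P
  proof -
    have "outcome_prob \<rho> P \<le> 1"
      using member_le_sum[of P \<P> "outcome_prob \<rho>"] sum_outcome_prob[OF assms] assms(2) nonneg that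
      by (simp add: von_neumann_measurement_def)
    then show ?thesis
      using nonneg[OF that]
      \<comment> \<open>At probability zero the product vanishes whatever \<open>log 2 0\<close>
        is.\<close>
      by (cases "outcome_prob \<rho> P = 0") (auto intro!: mult_nonneg_nonpos)
  qed
  then show ?thesis
    unfolding klein_entropy_def by (simp add: sum_nonpos)
qed

section \<open>Concavity of the entropy and the bound for separable states\<close>

lemma convex_on_mult_log: "convex_on {0..} (\<lambda>x::real. x * log 2 x)"
proof (rule convex_onI)
  \<comment> \<open>The left side is the tangent at \<open>z\<close> to the graph of
    \<open>x * ln x\<close>; the bound comes from \<open>ln y \<le> y - 1\<close> at
    \<open>y = z / x\<close>.\<close>
  have tangent: "x * ln z + (x - z) \<le> x * ln x" if "0 \<le> x" "0 < z" for x z :: real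
  proof (cases "x = 0")
    case False
    then have "x * ln (z / x) \<le> x * (z / x - 1)"
      using that by (intro mult_left_mono ln_le_minus_one) auto
    then show ?thesis
      using False that by (simp add: ln_div algebra_simps)
  qed (use that in simp)
  fix t x y :: real
  assume t: "0 < t" "t < 1" and x: "x \<in> {0..}" and y: "y \<in> {0..}"
  define z where "z = (1 - t) * x + t * y"
  have "z * ln z \<le> (1 - t) * (x * ln x) + t * (y * ln y)"
  proof (cases "z = 0")
    case True
    then have "x = 0" "y = 0"
      using t x y by (simp_all add: z_def add_nonneg_eq_0_iff)
    then show ?thesis by (simp add: z_def)
  next
    case False
    then have "z > 0"
      using t x y by (simp add: z_def less_le)
    \<comment> \<open>Both tangent bounds are taken at the weighted mean \<open>z\<close>, so the
      weighted corrections \<open>x - z\<close> and \<open>y - z\<close> cancel.\<close>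
    then have "(1 - t) * (x * ln z + (x - z)) + t * (y * ln z + (y - z))
        \<le> (1 - t) * (x * ln x) + t * (y * ln y)"
      using t x y by (intro add_mono mult_left_mono tangent) auto
    moreover have "(1 - t) * (x * ln z + (x - z)) + t * (y * ln z + (y - z)) = z * ln z + (z - z)"
      unfolding z_def by (simp add: algebra_simps)
    ultimately show ?thesis by simp
  qed
  then have "z * ln z / ln 2 \<le> ((1 - t) * (x * ln x) + t * (y * ln y)) / ln 2"
    by (intro divide_right_mono) auto
  then show "((1 - t) *\<^sub>R x + t *\<^sub>R y) * log 2 ((1 - t) *\<^sub>R x + t *\<^sub>R y)
      \<le> (1 - t) * (x * log 2 x) + t * (y * log 2 y)"
    by (simp add: log_def z_def add_divide_distrib)
qed simp

text \<open>Each outcome probability of the mixture is the mixture of the probabilities;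
  nonnegativity keeps them in the domain where \<open>x * log 2 x\<close> is convex.\<close>

lemma klein_entropy_concave:
  assumes "\<And>P. P \<in> \<P> \<Longrightarrow> 0 \<le> outcome_prob \<rho> P" "\<And>P. P \<in> \<P> \<Longrightarrow> 0 \<le> outcome_prob \<sigma> P"
    and "0 \<le> u" "0 \<le> v" "u + v = 1"
  shows "u * klein_entropy \<rho> \<P> + v * klein_entropy \<sigma> \<P> \<le> klein_entropy (u *\<^sub>R \<rho> + v *\<^sub>R \<sigma>) \<P>"
proof -
  let ?f = "\<lambda>x::real. x * log 2 x"
  have "(\<Sum>P\<in>\<P>. ?f (outcome_prob (u *\<^sub>R \<rho> + v *\<^sub>R \<sigma>) P))
      \<le> (\<Sum>P\<in>\<P>. u * ?f (outcome_prob \<rho> P) + v * ?f (outcome_prob \<sigma> P))"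
    using assms convex_on_mult_log
    by (intro sum_mono) (simp add: outcome_prob_add outcome_prob_scaleR convex_on_def)
  then show ?thesis
    by (simp add: klein_entropy_def sum.distrib sum_distrib_left)
qed

lemma INF_klein_entropy_le_separable:
  fixes \<rho> :: "complex ^ ('a::finite \<times> 'b::finite) ^ ('a \<times> 'b)"
  assumes "\<rho> \<in> separable_states" "von_neumann_measurement \<P>"
  shows "(INF \<delta> \<in> product_states. klein_entropy \<delta> \<P>) \<le> klein_entropy \<rho> \<P>"
proof -
  define m where
    "m = (INF \<delta> \<in> (product_states :: (complex ^ ('a \<times> 'b) ^ ('a \<times> 'b)) set). klein_entropy \<delta> \<P>)"
  \<comment> \<open>Nonnegative probabilities are built into \<open>S\<close> because concavity of
    the entropy, and hence convexity of \<open>S\<close>, relies on them.\<close>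
  define S :: "(complex ^ ('a \<times> 'b) ^ ('a \<times> 'b)) set" where
    "S = {\<sigma>. (\<forall>P\<in>\<P>. 0 \<le> outcome_prob \<sigma> P) \<and> m \<le> klein_entropy \<sigma> \<P>}"
  have product: "density_matrix \<delta>" if "\<delta> \<in> product_states" for \<delta> :: "complex ^ ('a \<times> 'b) ^ ('a \<times> 'b)"
    using that by (auto simp: product_states_def density_matrix_kron)
  have "product_states \<subseteq> S"
  proof
    fix \<delta> :: "complex ^ ('a \<times> 'b) ^ ('a \<times> 'b)"
    assume \<delta>: "\<delta> \<in> product_states"
    have "m \<le> klein_entropy \<delta> \<P>"
      unfolding m_def
      by (rule cINF_lower[OF bdd_belowI2[where m = 0] \<delta>])
        (simp add: klein_entropy_nonneg product assms(2))
    then show "\<delta> \<in> S"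
      using product[OF \<delta>] assms(2)
      by (auto simp: S_def density_matrix_def von_neumann_measurement_def
          intro: outcome_prob_nonneg)
  qed
  moreover have "convex S"
  proof (rule convexI)
    fix \<sigma> \<tau> and u v :: real
    assume *: "\<sigma> \<in> S" "\<tau> \<in> S" "0 \<le> u" "0 \<le> v" "u + v = 1"
    have "m = u * m + v * m"
      using * by (simp flip: distrib_right)
    also have "\<dots> \<le> u * klein_entropy \<sigma> \<P> + v * klein_entropy \<tau> \<P>"
      using * by (intro add_mono mult_left_mono) (auto simp: S_def)
    also have "\<dots> \<le> klein_entropy (u *\<^sub>R \<sigma> + v *\<^sub>R \<tau>) \<P>"
      using * by (intro klein_entropy_concave) (auto simp: S_def)
    finally show "u *\<^sub>R \<sigma> + v *\<^sub>R \<tau> \<in> S"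
      using * by (simp add: S_def outcome_prob_add outcome_prob_scaleR)
  qed
  ultimately have "separable_states \<subseteq> S"
    unfolding separable_states_def by (rule hull_minimal)
  then show ?thesis
    using assms(1) by (auto simp: S_def m_def)
qed

section \<open>The standard-basis measurement and the conclusion\<close>

lemma outer_axis: "outer (axis k 1) $ i $ j = (if i = k \<and> j = k then 1 else 0)"
  by (simp add: outer_def axis_def)

lemma outer_axis_mult:
  "outer (axis k 1) ** outer (axis l 1) = (if k = l then outer (axis k 1) else 0)"
proof -
  have "(outer (axis k 1) ** outer (axis l 1)) $ i $ j
      = (\<Sum>m\<in>UNIV. if m = k then (if i = k \<and> k = l \<and> j = l then 1 else 0) else 0)" for i j
    unfolding matrix_matrix_mult_def vec_lambda_beta
    by (intro sum.cong) (auto simp: outer_axis)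
  then show ?thesis
    by (auto simp: vec_eq_iff outer_axis)
qed

text \<open>Every row is zero or \<open>axis k 1\<close>, so this single vector is a basis of the
  row space.\<close>

lemma rank_outer_axis: "rank (outer (axis k 1) :: complex ^ 'n ^ 'n) = 1"
proof -
  have row: "row i (outer (axis k 1) :: complex ^ 'n ^ 'n) = (if i = k then axis k 1 else 0)" for i
    by (simp add: vec_eq_iff row_def outer_axis) (simp add: axis_def)
  have "axis k 1 \<in> rows (outer (axis k 1) :: complex ^ 'n ^ 'n)"
    unfolding rows_def by (force simp: row)
  moreover have "rows (outer (axis k 1) :: complex ^ 'n ^ 'n) \<subseteq> {0, axis k 1}"
    by (auto simp: rows_def row)
  moreover have "vec.independent {axis k 1 :: complex ^ 'n}"
    by (simp add: vec.independent_insert)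
  ultimately have "vec.dim (rows (outer (axis k 1) :: complex ^ 'n ^ 'n)) = card {axis k 1 :: complex ^ 'n}"
    by (intro vec.dim_unique[of "{axis k 1}"]) (auto intro: vec.span_base vec.span_zero)
  then show ?thesis
    by (simp add: row_rank_def_gen)
qed

text \<open>Witnesses that measurements exist: bounding a supremum of reals by a common upper bound
  requires a nonempty index set.\<close>

lemma von_neumann_measurement_standard:
  "von_neumann_measurement (range (\<lambda>k. outer (axis k 1) :: complex ^ 'n ^ 'n))"
proof -
  \<comment> \<open>A measurement is a set, so distinctness of the projectors is what turns the sum
    over it into a sum over basis indices.\<close>
  have inj: "inj (\<lambda>k. outer (axis k 1) :: complex ^ 'n ^ 'n)"
    by (rule injI) (metis outer_axis zero_neq_one)
  have "(\<Sum>P\<in>range (\<lambda>k. outer (axis k 1) :: complex ^ 'n ^ 'n). P) = (\<Sum>k\<in>UNIV. outer (axis k 1))"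
    by (simp add: sum.reindex[OF inj])
  also have "\<dots> = mat 1"
  proof -
    have "(\<Sum>k\<in>UNIV. outer (axis k 1) $ i $ j)
        = (\<Sum>k\<in>UNIV. if k = i then mat 1 $ i $ j else (0::complex))" for i j :: 'n
      by (intro sum.cong) (auto simp: outer_axis mat_def)
    then show ?thesis
      by (simp add: vec_eq_iff)
  qed
  finally show ?thesis
    by (auto simp: von_neumann_measurement_def rank_one_projector_def hermitian_iff outer_axis
        outer_axis_mult rank_outer_axis)
qed

theorem proposition1:
  fixes \<rho> :: "complex ^ ('a::finite \<times> 'b::finite) ^ ('a \<times> 'b)"
  assumes "\<rho> \<in> separable_states"
  shows "entanglement_parameter \<rho> \<le> 0"
  unfolding entanglement_parameter_def
proof (rule cSUP_least)
  show "{\<P> :: (complex ^ ('a \<times> 'b) ^ ('a \<times> 'b)) set. von_neumann_measurement \<P>} \<noteq> {}"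
    using von_neumann_measurement_standard by blast
qed (use INF_klein_entropy_le_separable[OF assms] in simp)

end
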